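(* Let $P^{\mathrm{cl}}_{\mathrm{prs},N}:Y_{\mathrm{prs}}\to Y_{\mathrm{prs}}$ be finite-rank bounded linear operators with $P^{\mathrm{cl}}_{\mathrm{prs},N}g\to g$ in $Y_{\mathrm{prs}}$ for every $g\in Y_{\mathrm{prs}}$ and $\sup_N\|P^{\mathrm{cl}}_{\mathrm{prs},N}\|_{Y_{\mathrm{prs}}\to Y_{\mathrm{prs}}}=C_P<\infty$. Assume the selected clean pressure image $\mathcal G_{\Lambda,0}\subset Y_{\mathrm{prs}}$ has compact closure in $Y_{\mathrm{prs}}$. Then $$\Delta^{\mathrm{unif}}_{\mathrm{proj},N}(\mathcal A_\Lambda)=\sup_{g\in\mathcal G_{\Lambda,0}}\|(I-P^{\mathrm{cl}}_{\mathrm{prs},N})g\|_{Y_{\mathrm{prs}}}\longrightarrow0\qquad(N\to\infty).$$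
   Context: $Y_{\mathrm{prs}}=L^{3/2}((-1,0);L^{3/2}(B_{1/2}))$ and $X_{\mathrm{src}}=L^{3/2}((-1,0);L^{3/2}(B_1))^{3\times3}$, balls in $\mathbb R^3$. For $F\in X_{\mathrm{src}}$, $\mathcal R(F)=R_iR_j(F_{ij})$ (Riesz transforms in $x$ of the zero extension, summed over $i,j$, restricted to $B_{1/2}$), a bounded linear map $X_{\mathrm{src}}\to Y_{\mathrm{prs}}$. $\mathcal A_\Lambda$ is a class of packages; each $D\in\mathcal A_\Lambda$, after shifting by its selected gauge representative $\zeta_0(D)$, has a clean source $F^{\mathrm{cl}}_{D-\zeta_0(D)}\in X_{\mathrm{src}}$. The selected clean pressure image is $\mathcal G_{\Lambda,0}=\{\mathcal R(F^{\mathrm{cl}}_{D-\zeta_0(D)}):D\in\mathcal A_\Lambda\}$ and the uniform clean projection-tail error is $\Delta^{\mathrm{unif}}_{\mathrm{proj},N}(\mathcal A_\Lambda)=\sup_{D\in\mathcal A_\Lambda}\|(I-P^{\mathrm{cl}}_{\mathrm{prs},N})\mathcal R(F^{\mathrm{cl}}_{D-\zeta_0(D)})\|_{Y_{\mathrm{prs}}}$. *)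

theory Defs
  imports "HOL-Analysis.Analysis"
begin

text \<open>
  Lebesgue--Bochner classes over a measure \<open>M\<close> with values in a real normed space. Strong
  (Bochner) measurability is used instead of Borel measurability because the target may itself be
  a Lebesgue space, for which no \<open>second_countable_topology\<close> instance is at hand; for second
  countable targets such as \<open>real\<close> the two notions agree.
\<close>

definition strongly_measurable :: "'a measure \<Rightarrow> ('a \<Rightarrow> 'b::real_normed_vector) \<Rightarrow> bool" where
  "strongly_measurable M f \<longleftrightarrow>
     (\<exists>s. (\<forall>i. simple_function M (s i)) \<and> (\<forall>x\<in>space M. (\<lambda>i::nat. s i x) \<longlonglongrightarrow> f x))"

lemma strongly_measurable_iff_borel:
  fixes f :: "'a \<Rightarrow> 'b::{real_normed_vector, second_countable_topology}"
  shows "strongly_measurable M f \<longleftrightarrow> f \<in> borel_measurable M"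
proof
  assume "strongly_measurable M f"
  then obtain s where s: "\<And>i. simple_function M (s i)"
    and l: "\<And>x. x \<in> space M \<Longrightarrow> (\<lambda>i::nat. s i x) \<longlonglongrightarrow> f x"
    unfolding strongly_measurable_def by blast
  show "f \<in> borel_measurable M"
    by (rule borel_measurable_LIMSEQ_metric[of s])
      (use s l in \<open>auto intro: borel_measurable_simple_function\<close>)
next
  assume "f \<in> borel_measurable M"
  from borel_measurable_implies_sequence_metric[OF this, of 0]
  show "strongly_measurable M f" unfolding strongly_measurable_def by blast
qed

lemma strongly_measurable_norm:
  assumes "strongly_measurable M f"
  shows "(\<lambda>x. norm (f x)) \<in> borel_measurable M"
proof -
  from assms obtain s where s: "\<And>i. simple_function M (s i)"
    and l: "\<And>x. x \<in> space M \<Longrightarrow> (\<lambda>i::nat. s i x) \<longlonglongrightarrow> f x"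
    unfolding strongly_measurable_def by blast
  show ?thesis
  proof (rule borel_measurable_LIMSEQ_real[of _ "\<lambda>i x. norm (s i x)"])
    show "(\<lambda>i. norm (s i x)) \<longlonglongrightarrow> norm (f x)" if "x \<in> space M" for x
      using l[OF that] by (rule tendsto_norm)
    show "(\<lambda>x. norm (s i x)) \<in> borel_measurable M" for i
      using simple_function_compose1[OF s, of norm i] by (rule borel_measurable_simple_function)
  qed
qed

lemma strongly_measurable_const: "strongly_measurable M (\<lambda>x. c)"
  unfolding strongly_measurable_def by (rule exI[of _ "\<lambda>i x. c"]) simp

lemma strongly_measurable_add:
  assumes "strongly_measurable M f" "strongly_measurable M g"
  shows "strongly_measurable M (\<lambda>x. f x + g x)"
proof -
  obtain s where s: "\<And>i. simple_function M (s i)"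
      "\<And>x. x \<in> space M \<Longrightarrow> (\<lambda>i::nat. s i x) \<longlonglongrightarrow> f x"
    using assms(1) unfolding strongly_measurable_def by blast
  obtain u where u: "\<And>i. simple_function M (u i)"
      "\<And>x. x \<in> space M \<Longrightarrow> (\<lambda>i::nat. u i x) \<longlonglongrightarrow> g x"
    using assms(2) unfolding strongly_measurable_def by blast
  show ?thesis unfolding strongly_measurable_def
    by (rule exI[of _ "\<lambda>i x. s i x + u i x"])
      (auto intro!: simple_function_compose2[where h="(+)"] tendsto_add s u)
qed

lemma strongly_measurable_scaleR:
  assumes "strongly_measurable M f"
  shows "strongly_measurable M (\<lambda>x. r *\<^sub>R f x)"
proof -
  obtain s where s: "\<And>i. simple_function M (s i)"
      "\<And>x. x \<in> space M \<Longrightarrow> (\<lambda>i::nat. s i x) \<longlonglongrightarrow> f x"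
    using assms(1) unfolding strongly_measurable_def by blast
  show ?thesis unfolding strongly_measurable_def
    by (rule exI[of _ "\<lambda>i x. r *\<^sub>R s i x"])
      (auto intro!: simple_function_compose1[where g="\<lambda>y. r *\<^sub>R y"] tendsto_intros s)
qed

definition Lp_fun :: "real \<Rightarrow> 'a measure \<Rightarrow> ('a \<Rightarrow> 'b::real_normed_vector) set" where
  "Lp_fun p M = {f. strongly_measurable M f \<and> integrable M (\<lambda>x. norm (f x) powr p)}"

definition Lp_norm :: "real \<Rightarrow> 'a measure \<Rightarrow> ('a \<Rightarrow> 'b::real_normed_vector) \<Rightarrow> real" where
  "Lp_norm p M f = (LINT x|M. norm (f x) powr p) powr (1 / p)"

definition Lp_eq ::
    "real \<Rightarrow> 'a measure \<Rightarrow> ('a \<Rightarrow> 'b::real_normed_vector) \<Rightarrow> ('a \<Rightarrow> 'b) \<Rightarrow> bool" where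
  "Lp_eq p M f g \<longleftrightarrow> f \<in> Lp_fun p M \<and> g \<in> Lp_fun p M \<and> (AE x in M. f x = g x)"

lemma powr_convex_split:
  fixes s t l p :: real
  assumes "p \<ge> 1" "0 < l" "l < 1" "s \<ge> 0" "t \<ge> 0"
  shows "(s + t) powr p \<le> l * (s / l) powr p + (1 - l) * (t / (1 - l)) powr p"
proof -
  have *: "(m * w) powr p \<le> m * w powr p" if "0 < m" "m < 1" "w \<ge> 0" for m w :: real
  proof -
    have "m powr p \<le> m powr 1" using that assms by (intro powr_mono') auto
    then show ?thesis using that by (simp add: powr_mult mult_right_mono)
  qed
  consider "s = 0" | "t = 0" | "s > 0" "t > 0" using assms by linarith
  then show ?thesis
  proof cases
    case 1 then show ?thesis using *[of "1 - l" "t / (1 - l)"] assms by simp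
  next
    case 2 then show ?thesis using *[of l "s / l"] assms by simp
  next
    case 3
    have "(l *\<^sub>R (s / l) + (1 - l) *\<^sub>R (t / (1 - l))) powr p
        \<le> l * (s / l) powr p + (1 - l) * (t / (1 - l)) powr p"
      using convex_onD[OF powr_convex[OF assms(1)], of "1 - l" "s / l" "t / (1 - l)"] assms 3
      by simp
    then show ?thesis using assms by simp
  qed
qed

lemma Lp_add_aux:
  assumes p: "p \<ge> 1" and f: "f \<in> Lp_fun p M" and g: "g \<in> Lp_fun p M" and l: "0 < l" "l < 1"
  shows "(\<lambda>x. f x + g x) \<in> Lp_fun p M"
    and "(LINT x|M. norm (f x + g x) powr p) \<le>
      l * ((LINT x|M. norm (f x) powr p) / l powr p) +
      (1 - l) * ((LINT x|M. norm (g x) powr p) / (1 - l) powr p)"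
proof -
  let ?h = "\<lambda>x. l * (norm (f x) powr p / l powr p) +
      (1 - l) * (norm (g x) powr p / (1 - l) powr p)"
  have sm: "strongly_measurable M f" "strongly_measurable M g"
    and i: "integrable M (\<lambda>x. norm (f x) powr p)" "integrable M (\<lambda>x. norm (g x) powr p)"
    using f g by (auto simp: Lp_fun_def)
  have sma: "strongly_measurable M (\<lambda>x. f x + g x)" by (rule strongly_measurable_add[OF sm])
  have meas: "(\<lambda>x. norm (f x + g x) powr p) \<in> borel_measurable M"
    using strongly_measurable_norm[OF sma] by measurable
  have bd: "norm (f x + g x) powr p \<le> ?h x" for x
  proof -
    have "norm (f x + g x) powr p \<le> (norm (f x) + norm (g x)) powr p"
      using p by (intro powr_mono2) (auto intro: norm_triangle_ineq)
    also have "\<dots> \<le> ?h x"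
      using powr_convex_split[OF p l, of "norm (f x)" "norm (g x)"] l by (simp add: powr_divide)
    finally show ?thesis .
  qed
  have ih: "integrable M ?h" using i by (intro Bochner_Integration.integrable_add) auto
  have ia: "integrable M (\<lambda>x. norm (f x + g x) powr p)"
  proof (rule Bochner_Integration.integrable_bound[OF ih meas], rule AE_I2)
    show "norm (norm (f x + g x) powr p) \<le> norm (?h x)" for x
      using order_trans[OF bd[of x] abs_ge_self] by simp
  qed
  show "(\<lambda>x. f x + g x) \<in> Lp_fun p M" using sma ia by (simp add: Lp_fun_def)
  have "(LINT x|M. norm (f x + g x) powr p) \<le> (LINT x|M. ?h x)"
    by (rule integral_mono[OF ia ih bd])
  also have "\<dots> = l * ((LINT x|M. norm (f x) powr p) / l powr p) +
      (1 - l) * ((LINT x|M. norm (g x) powr p) / (1 - l) powr p)"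
    using i by simp
  finally show "(LINT x|M. norm (f x + g x) powr p) \<le> \<dots>" .
qed

lemma Lp_fun_add:
  assumes "p \<ge> 1" "f \<in> Lp_fun p M" "g \<in> Lp_fun p M"
  shows "(\<lambda>x. f x + g x) \<in> Lp_fun p M"
  using Lp_add_aux(1)[OF assms, of "1/2"] by simp

lemma Lp_norm_nonneg: "0 \<le> Lp_norm p M f" by (simp add: Lp_norm_def)

lemma Lp_norm_triangle:
  assumes p: "p \<ge> 1" and f: "f \<in> Lp_fun p M" and g: "g \<in> Lp_fun p M"
  shows "Lp_norm p M (\<lambda>x. f x + g x) \<le> Lp_norm p M f + Lp_norm p M g"
proof (rule field_le_epsilon)
  fix e :: real assume e: "e > 0"
  define a b where "a = Lp_norm p M f + e / 2" and "b = Lp_norm p M g + e / 2"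
  have ab: "a > 0" "b > 0" using e Lp_norm_nonneg[of p M f] Lp_norm_nonneg[of p M g]
    by (auto simp: a_def b_def)
  have le: "(LINT x|M. norm (h x) powr p) \<le> c powr p" if "Lp_norm p M h \<le> c"
    for h c and dummy :: "'a \<Rightarrow> 'b"
  proof -
    have "(LINT x|M. norm (h x) powr p) = Lp_norm p M h powr p"
      using p by (simp add: Lp_norm_def powr_powr)
    also have "\<dots> \<le> c powr p" using that p Lp_norm_nonneg by (intro powr_mono2) auto
    finally show ?thesis .
  qed
  let ?l = "a / (a + b)"
  have l: "0 < ?l" "?l < 1" and l': "1 - ?l = b / (a + b)" using ab by (auto simp: field_simps)
  have "(LINT x|M. norm (f x + g x) powr p) \<le>
      ?l * ((LINT x|M. norm (f x) powr p) / ?l powr p) +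
      (1 - ?l) * ((LINT x|M. norm (g x) powr p) / (1 - ?l) powr p)"
    by (rule Lp_add_aux(2)[OF p f g l])
  also have "\<dots> \<le> ?l * (a powr p / ?l powr p) + (1 - ?l) * (b powr p / (1 - ?l) powr p)"
    using l e by (intro add_mono mult_left_mono divide_right_mono le) (auto simp: a_def b_def)
  also have "\<dots> = ?l * (a + b) powr p + (1 - ?l) * (a + b) powr p"
    unfolding l' using ab by (simp add: powr_divide)
  also have "\<dots> = (a + b) powr p" by (simp add: algebra_simps)
  finally have "Lp_norm p M (\<lambda>x. f x + g x) \<le> ((a + b) powr p) powr (1 / p)"
    unfolding Lp_norm_def using p by (intro powr_mono2) auto
  also have "\<dots> = a + b" using ab p by (simp add: powr_powr)
  finally show "Lp_norm p M (\<lambda>x. f x + g x) \<le> Lp_norm p M f + Lp_norm p M g + e"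
    by (simp add: a_def b_def)
qed

lemma Lp_fun_scaleR:
  assumes "f \<in> Lp_fun p M" shows "(\<lambda>x. r *\<^sub>R f x) \<in> Lp_fun p M"
  using assms by (auto simp: Lp_fun_def powr_mult strongly_measurable_scaleR)

lemma Lp_norm_scaleR:
  assumes "p \<ge> 1"
  shows "Lp_norm p M (\<lambda>x. r *\<^sub>R f x) = \<bar>r\<bar> * Lp_norm p M f"
  using assms by (simp add: Lp_norm_def powr_mult powr_powr)

lemma Lp_fun_zero: "(\<lambda>x. 0) \<in> Lp_fun p M"
  by (simp add: Lp_fun_def strongly_measurable_const)

lemma Lp_norm_eq_0_iff:
  assumes "f \<in> Lp_fun p M"
  shows "Lp_norm p M f = 0 \<longleftrightarrow> (AE x in M. f x = 0)"
  using assms integral_nonneg_eq_0_iff_AE[of M "\<lambda>x. norm (f x) powr p"]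
  by (simp add: Lp_fun_def Lp_norm_def)

lemma Lp_eq_part_equivp: "part_equivp (Lp_eq p M)"
proof (rule part_equivpI)
  show "\<exists>f. Lp_eq p M f f" using Lp_fun_zero by (intro exI[of _ "\<lambda>x. 0"]) (auto simp: Lp_eq_def)
  show "symp (Lp_eq p M)" by (auto simp: Lp_eq_def symp_def eq_commute)
  show "transp (Lp_eq p M)"
    unfolding Lp_eq_def transp_def by (auto elim: AE_mp)
qed

lemma Lp_eq_zero: "Lp_eq p M (\<lambda>x. 0) (\<lambda>x. 0)"
  by (simp add: Lp_eq_def Lp_fun_zero)

lemma Lp_eq_add:
  assumes "p \<ge> 1" "Lp_eq p M f f'" "Lp_eq p M g g'"
  shows "Lp_eq p M (\<lambda>x. f x + g x) (\<lambda>x. f' x + g' x)"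
proof -
  have "AE x in M. f x = f' x" "AE x in M. g x = g' x" using assms by (auto simp: Lp_eq_def)
  then have "AE x in M. f x + g x = f' x + g' x" by eventually_elim simp
  then show ?thesis using assms by (auto simp: Lp_eq_def intro: Lp_fun_add)
qed

lemma Lp_eq_scaleR:
  assumes "Lp_eq p M f f'"
  shows "Lp_eq p M (\<lambda>x. r *\<^sub>R f x) (\<lambda>x. r *\<^sub>R f' x)"
  using assms by (auto simp: Lp_eq_def intro: Lp_fun_scaleR)

lemma Lp_eq_uminus: "Lp_eq p M f f' \<Longrightarrow> Lp_eq p M (\<lambda>x. - f x) (\<lambda>x. - f' x)"
  using Lp_eq_scaleR[of p M f f' "-1"] by simp

lemma Lp_eq_diff:
  "p \<ge> 1 \<Longrightarrow> Lp_eq p M f f' \<Longrightarrow> Lp_eq p M g g' \<Longrightarrow> Lp_eq p M (\<lambda>x. f x - g x) (\<lambda>x. f' x - g' x)"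
  using Lp_eq_add[of p M f f' "\<lambda>x. - g x" "\<lambda>x. - g' x"] Lp_eq_uminus[of p M g g'] by simp

lemma Lp_norm_cong:
  assumes "Lp_eq p M f f'" shows "Lp_norm p M f = Lp_norm p M f'"
proof -
  have m: "f \<in> Lp_fun p M" "f' \<in> Lp_fun p M" "AE x in M. f x = f' x"
    using assms by (auto simp: Lp_eq_def)
  have "(LINT x|M. norm (f x) powr p) = (LINT x|M. norm (f' x) powr p)"
    by (rule integral_cong_AE) (use m in \<open>auto simp: Lp_fun_def elim: AE_mp\<close>)
  then show ?thesis by (simp add: Lp_norm_def)
qed

lemma Lp_norm_eq_0_iff_Lp_eq:
  assumes "Lp_eq p M f f"
  shows "Lp_norm p M f = 0 \<longleftrightarrow> Lp_eq p M f (\<lambda>x. 0)"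
  using assms Lp_norm_eq_0_iff[of f p M] by (auto simp: Lp_eq_def Lp_fun_zero)

lemma Lp_refl_fun: "Lp_eq p M f f \<Longrightarrow> f \<in> Lp_fun p M"
  by (simp add: Lp_eq_def)

text \<open>
  Domains of integration are types carrying a measure, so that the Lebesgue space below is an
  ordinary type in the class of real normed spaces. The domains needed here are subsets \<open>S\<close> of
  Euclidean spaces, with Lebesgue measure transported along the bijection between \<open>S\<close> and the type.
\<close>

class measured_domain =
  fixes domain_measure :: "'a measure"

definition subtype_lborel ::
    "('s \<Rightarrow> 'a::euclidean_space) \<Rightarrow> ('a \<Rightarrow> 's) \<Rightarrow> 'a set \<Rightarrow> 's measure" where
  "subtype_lborel Rep Abs S =
     distr (restrict_space lborel S) (vimage_algebra UNIV Rep borel) Abs"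

lemma emeasure_subtype_lborel:
  assumes "type_definition Rep Abs S" "S \<in> sets borel" "A \<in> sets borel"
  shows "emeasure (subtype_lborel Rep Abs S) (Rep -` A) = emeasure lborel (A \<inter> S)"
proof -
  interpret type_definition Rep Abs S by fact
  have S: "S \<in> sets lborel" using assms by simp
  have "(\<lambda>x. Rep (Abs x)) \<in> measurable (restrict_space lborel S) borel"
    by (subst measurable_cong[where g="\<lambda>x. x"])
      (auto simp: Abs_inverse space_restrict_space intro!: measurable_restrict_space1)
  then have m: "Abs \<in> measurable (restrict_space lborel S) (vimage_algebra UNIV Rep borel)"
    by (intro measurable_vimage_algebra2) auto
  have "Rep -` A \<in> sets (vimage_algebra UNIV Rep borel)"
    using in_vimage_algebra[OF assms(3), of Rep UNIV] by simp
  moreover have "Abs -` (Rep -` A) \<inter> space (restrict_space lborel S) = A \<inter> S"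
    by (auto simp: space_restrict_space Abs_inverse)
  ultimately show ?thesis
    using S by (simp add: subtype_lborel_def emeasure_distr[OF m] emeasure_restrict_space)
qed

text \<open>The time interval and the balls of radius \<open>1\<close> and \<open>1/2\<close>.\<close>

typedef time = "{-1<..<0::real}" by (rule exI[of _ "-1/2"]) simp
typedef unit_ball = "ball (0::real^3) 1" by (rule exI[of _ 0]) simp
typedef half_ball = "ball (0::real^3) (1/2)" by (rule exI[of _ 0]) simp

instantiation time :: measured_domain
begin
definition "domain_measure = subtype_lborel Rep_time Abs_time {-1<..<0}"
instance ..
end

instantiation unit_ball :: measured_domain
begin
definition "domain_measure = subtype_lborel Rep_unit_ball Abs_unit_ball (ball 0 1)"
instance ..
end

instantiation half_ball :: measured_domain
begin
definition "domain_measure = subtype_lborel Rep_half_ball Abs_half_ball (ball 0 (1/2))"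
instance ..
end

text \<open>The Bochner space \<open>L\<^sup>3\<^sup>/\<^sup>2\<close> over the domain \<open>'a\<close> with values in \<open>'b\<close>, modulo null sets.\<close>

quotient_type (overloaded) ('a, 'b) L32 =
  "'a::measured_domain \<Rightarrow> 'b::real_normed_vector" / partial: "Lp_eq (3/2) domain_measure"
  by (rule Lp_eq_part_equivp)

instantiation L32 :: (measured_domain, real_normed_vector) real_normed_vector
begin

lift_definition zero_L32 :: "('a, 'b) L32" is "\<lambda>t. 0" by (rule Lp_eq_zero)
lift_definition plus_L32 :: "('a, 'b) L32 \<Rightarrow> ('a, 'b) L32 \<Rightarrow> ('a, 'b) L32"
  is "\<lambda>f g t. f t + g t" by (rule Lp_eq_add) auto
lift_definition minus_L32 :: "('a, 'b) L32 \<Rightarrow> ('a, 'b) L32 \<Rightarrow> ('a, 'b) L32"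
  is "\<lambda>f g t. f t - g t" by (rule Lp_eq_diff) auto
lift_definition uminus_L32 :: "('a, 'b) L32 \<Rightarrow> ('a, 'b) L32"
  is "\<lambda>f t. - f t" by (rule Lp_eq_uminus)
lift_definition scaleR_L32 :: "real \<Rightarrow> ('a, 'b) L32 \<Rightarrow> ('a, 'b) L32"
  is "\<lambda>r f t. r *\<^sub>R f t" by (rule Lp_eq_scaleR)
lift_definition norm_L32 :: "('a, 'b) L32 \<Rightarrow> real"
  is "Lp_norm (3/2) domain_measure" by (rule Lp_norm_cong)

definition dist_L32 :: "('a, 'b) L32 \<Rightarrow> ('a, 'b) L32 \<Rightarrow> real" where
  "dist_L32 f g = norm (f - g)"
definition sgn_L32 :: "('a, 'b) L32 \<Rightarrow> ('a, 'b) L32" where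
  "sgn_L32 f = inverse (norm f) *\<^sub>R f"
definition uniformity_L32 :: "(('a, 'b) L32 \<times> ('a, 'b) L32) filter" where
  "uniformity_L32 = (INF e\<in>{0<..}. principal {(f, g). dist f g < e})"
definition open_L32 :: "('a, 'b) L32 set \<Rightarrow> bool" where
  "open_L32 U \<longleftrightarrow> (\<forall>f\<in>U. eventually (\<lambda>(f', g). f' = f \<longrightarrow> g \<in> U) uniformity)"

instance
proof
  fix f g h :: "('a, 'b) L32" and r s :: real
  show "f + g + h = f + (g + h)"
    by transfer (auto simp: algebra_simps intro!: Lp_eq_add)
  show "f + g = g + f"
    by transfer (auto simp: add.commute dest: Lp_eq_add[rotated])
  show "0 + f = f" by transfer simp
  show "- f + f = 0" by transfer (simp add: Lp_eq_zero)
  show "f - g = f + - g"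
    by transfer (auto dest: Lp_eq_diff[rotated])
  show "r *\<^sub>R (f + g) = r *\<^sub>R f + r *\<^sub>R g"
    by transfer (simp add: scaleR_add_right Lp_eq_add Lp_eq_scaleR)
  show "(r + s) *\<^sub>R f = r *\<^sub>R f + s *\<^sub>R f"
    by transfer (simp add: scaleR_add_left Lp_eq_add Lp_eq_scaleR)
  show "r *\<^sub>R s *\<^sub>R f = (r * s) *\<^sub>R f"
    by transfer (simp add: Lp_eq_scaleR)
  show "1 *\<^sub>R f = f" by transfer simp
  show "norm f = 0 \<longleftrightarrow> f = 0" by transfer (rule Lp_norm_eq_0_iff_Lp_eq)
  show "norm (f + g) \<le> norm f + norm g"
    by transfer (auto intro!: Lp_norm_triangle dest: Lp_refl_fun)
  show "norm (r *\<^sub>R f) = \<bar>r\<bar> * norm f" by transfer (rule Lp_norm_scaleR, simp)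
qed (simp_all add: dist_L32_def sgn_L32_def uniformity_L32_def open_L32_def)

end

type_synonym Y_prs = "(time, (half_ball, real) L32) L32"
type_synonym X_src = "(time, (unit_ball, real) L32) L32^3^3"

text \<open>
  The \<open>j\<close>-th Riesz transform on \<open>\<real>\<^sup>3\<close> as a principal value singular integral. The constant is
  \<open>\<Gamma>((n+1)/2) / \<pi>\<^sup>(\<^sup>n\<^sup>+\<^sup>1\<^sup>)\<^sup>/\<^sup>2\<close> for \<open>n = 3\<close>. For \<open>f\<close> of class \<open>L\<^sup>3\<^sup>/\<^sup>2\<close> the limit exists for almost
  every \<open>x\<close>; the value elsewhere is irrelevant.
\<close>

definition riesz :: "3 \<Rightarrow> (real^3 \<Rightarrow> real) \<Rightarrow> real^3 \<Rightarrow> real" where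
  "riesz j f x = Lim (at_right 0) (\<lambda>\<epsilon>.
     1 / pi\<^sup>2 * (LINT y:{y. \<epsilon> < norm (x - y)}|lborel. (x $ j - y $ j) / norm (x - y) ^ 4 * f y))"

definition zero_ext :: "(unit_ball, real) L32 \<Rightarrow> real^3 \<Rightarrow> real" where
  "zero_ext f x = (if x \<in> ball 0 1 then rep_L32 f (Abs_unit_ball x) else 0)"

text \<open>
  The functions passed to \<open>abs_L32\<close> below are of class \<open>L\<^sup>3\<^sup>/\<^sup>2\<close> by the Calderon--Zygmund theorem,
  and their classes do not depend on the representatives chosen.
\<close>

definition riesz2_half_ball :: "3 \<Rightarrow> 3 \<Rightarrow> (unit_ball, real) L32 \<Rightarrow> (half_ball, real) L32" where
  "riesz2_half_ball i j f = abs_L32 (\<lambda>x. riesz i (riesz j (zero_ext f)) (Rep_half_ball x))"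

definition pressure_map :: "X_src \<Rightarrow> Y_prs" where
  "pressure_map F =
     abs_L32 (\<lambda>t. \<Sum>i\<in>UNIV. \<Sum>j\<in>UNIV. riesz2_half_ball i j (rep_L32 (F $ i $ j) t))"

definition finite_rank :: "('a::real_normed_vector \<Rightarrow>\<^sub>L 'b::real_normed_vector) \<Rightarrow> bool" where
  "finite_rank T \<longleftrightarrow> (\<exists>B. finite B \<and> range (blinfun_apply T) \<subseteq> span B)"

text \<open>
  A class \<open>A\<close> of packages enters only through the gauge selection \<open>\<zeta>\<close>, the shift
  \<open>shift D z\<close> of a package \<open>D\<close> by a gauge representative \<open>z\<close> (written \<open>D - z\<close>), and the clean
  source \<open>Fcl\<close> of a shifted package.
\<close>

definition selected_clean_image ::
    "'d set \<Rightarrow> ('d \<Rightarrow> 'g \<Rightarrow> 'e) \<Rightarrow> ('d \<Rightarrow> 'g) \<Rightarrow> ('e \<Rightarrow> X_src) \<Rightarrow> Y_prs set" where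
  "selected_clean_image A shift \<zeta> Fcl = {pressure_map (Fcl (shift D (\<zeta> D))) | D. D \<in> A}"

text \<open>Extended nonnegative values give the supremum its usual meaning: 0 for an empty class,
  \<open>\<infinity>\<close> for an unbounded one.\<close>

definition proj_tail_error ::
    "'d set \<Rightarrow> ('d \<Rightarrow> 'g \<Rightarrow> 'e) \<Rightarrow> ('d \<Rightarrow> 'g) \<Rightarrow> ('e \<Rightarrow> X_src) \<Rightarrow> (Y_prs \<Rightarrow>\<^sub>L Y_prs) \<Rightarrow> ennreal" where
  "proj_tail_error A shift \<zeta> Fcl P =
     (SUP D\<in>A. ennreal (norm ((id_blinfun - P) (pressure_map (Fcl (shift D (\<zeta> D)))))))"

end

theory Submission
  imports Defs
begin

text \<open>
  The operators \<open>I - P\<^sub>N\<close> are uniformly bounded, hence equicontinuous, and tend to zero pointwise.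
  On a finite net of the compact closure the convergence is uniform, and equicontinuity carries it
  from the net to the whole set.
\<close>

lemma pointwise_null_blinfun_uniform_on_compact:
  fixes T :: "nat \<Rightarrow> 'a::real_normed_vector \<Rightarrow>\<^sub>L 'b::real_normed_vector"
  assumes lim: "\<And>x. (\<lambda>n. T n x) \<longlonglongrightarrow> 0"
    and bd: "\<And>n. norm (T n) \<le> C"
    and K: "compact K"
    and e: "e > 0"
  shows "\<forall>\<^sub>F n in sequentially. \<forall>x\<in>K. norm (T n x) < e"
proof -
  have C: "C \<ge> 0" using bd[of 0] norm_ge_zero[of "T 0"] by linarith
  \<comment> \<open>The radius makes \<open>C * d\<close> strictly less than half of
    \<open>e\<close>; the summand 1 keeps the denominator positive when
    \<open>C = 0\<close>.\<close>
  define d where "d = e / (2 * (C + 1))"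
  have d: "d > 0" and Cd: "C * d < e / 2"
    using C e by (auto simp: d_def field_simps)
  obtain F where F: "finite F" "K \<subseteq> (\<Union>y\<in>F. ball y d)"
    using K d unfolding compact_eq_totally_bounded by blast
  have "\<forall>\<^sub>F n in sequentially. \<forall>y\<in>F. norm (T n y) < e / 2"
    using F(1) tendstoD[OF lim, of "e / 2"] e
    by (auto intro!: eventually_ball_finite)
  then show ?thesis
  proof (rule eventually_mono, intro ballI)
    fix n x assume n: "\<forall>y\<in>F. norm (T n y) < e / 2" and x: "x \<in> K"
    obtain y where y: "y \<in> F" "norm (x - y) < d"
      using F(2) x by (auto simp: dist_norm norm_minus_commute)
    \<comment> \<open>Splitting \<open>x\<close> as \<open>(x - y) + y\<close> leaves one half of
      \<open>e\<close> to the operator bound and the other half to the net point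
      \<open>y\<close>.\<close>
    have "norm (T n (x - y)) \<le> C * d"
      using bd[of n] y(2) C by (intro order_trans[OF norm_blinfun] mult_mono) auto
    moreover have "norm (T n x) \<le> norm (T n (x - y)) + norm (T n y)"
      using norm_triangle_ineq[of "T n (x - y)" "T n y"] by (simp add: blinfun.diff_right)
    ultimately show "norm (T n x) < e" using n y(1) Cd by fastforce
  qed
qed

text \<open>A bound uniform over \<open>S\<close> passes to the supremum, also for empty
  \<open>S\<close>, whose supremum in \<open>ennreal\<close> is 0.\<close>

lemma tendsto_SUP_norm_0:
  fixes f :: "nat \<Rightarrow> 'a \<Rightarrow> 'b::real_normed_vector"
  assumes "\<And>e. e > 0 \<Longrightarrow> \<forall>\<^sub>F n in sequentially. \<forall>x\<in>S. norm (f n x) < e"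
  shows "(\<lambda>n. SUP x\<in>S. ennreal (norm (f n x))) \<longlonglongrightarrow> 0"
proof (rule order_tendstoI)
  fix a :: ennreal assume "0 < a"
  \<comment> \<open>The supremum inherits only a non-strict bound, so room is needed strictly below
    \<open>a\<close>. Being below \<open>a\<close>, \<open>r\<close> is finite even if
    \<open>a\<close> is \<infinity>, hence comes from a real \<open>e\<close>.\<close>
  then obtain r where "0 < r" "r < a" using dense by blast
  then obtain e where e: "e > 0" "ennreal e < a"
    by (cases r) auto
  have "\<forall>\<^sub>F n in sequentially. (SUP x\<in>S. ennreal (norm (f n x))) \<le> ennreal e"
    using assms[OF e(1)] by eventually_elim (rule SUP_least, simp add: ennreal_leI less_imp_le)
  then show "\<forall>\<^sub>F n in sequentially. (SUP x\<in>S. ennreal (norm (f n x))) < a"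
    by eventually_elim (use e(2) in auto)
qed simp

theorem theoremA8:
  fixes A :: "'d set"
    and shift :: "'d \<Rightarrow> 'g \<Rightarrow> 'e"
    and \<zeta> :: "'d \<Rightarrow> 'g"
    and Fcl :: "'e \<Rightarrow> X_src"
    and P :: "nat \<Rightarrow> Y_prs \<Rightarrow>\<^sub>L Y_prs"
    and C_P :: real
  assumes "\<And>N. finite_rank (P N)"
    and "\<And>g. (\<lambda>N. P N g) \<longlonglongrightarrow> g"
    and "bdd_above (range (\<lambda>N. norm (P N)))"
    and "(SUP N. norm (P N)) = C_P"
    and "compact (closure (selected_clean_image A shift \<zeta> Fcl))"
  shows "(\<forall>N. proj_tail_error A shift \<zeta> Fcl (P N) =
            (SUP g\<in>selected_clean_image A shift \<zeta> Fcl. ennreal (norm ((id_blinfun - P N) g))))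
       \<and> (\<lambda>N. proj_tail_error A shift \<zeta> Fcl (P N)) \<longlonglongrightarrow> 0"
proof -
  let ?G = "selected_clean_image A shift \<zeta> Fcl"
  have eq: "proj_tail_error A shift \<zeta> Fcl (P N) =
      (SUP g\<in>?G. ennreal (norm ((id_blinfun - P N) g)))" for N
    unfolding proj_tail_error_def selected_clean_image_def Setcompr_eq_image image_image ..
  \<comment> \<open>The norm of the identity stays symbolic: any bound independent of
    \<open>N\<close> suffices, and its value 1 would require a nontrivial space.\<close>
  have bd: "norm (id_blinfun - P N) \<le> norm (id_blinfun :: Y_prs \<Rightarrow>\<^sub>L Y_prs) + C_P" for N
    using norm_triangle_ineq4[of id_blinfun "P N"] cSUP_upper[OF UNIV_I assms(3), of N] assms(4)
    by linarith
  have lim: "(\<lambda>N. (id_blinfun - P N) g) \<longlonglongrightarrow> 0" for g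
    using tendsto_diff[OF tendsto_const assms(2), of g g] by (simp add: blinfun.diff_left)
  \<comment> \<open>Uniformity is obtained on the compact closure and restricted to the image, which
    itself need not be closed.\<close>
  have "\<forall>\<^sub>F N in sequentially. \<forall>g\<in>?G. norm ((id_blinfun - P N) g) < e" if "e > 0" for e
    using pointwise_null_blinfun_uniform_on_compact[OF lim bd assms(5) that]
    by eventually_elim (use closure_subset in blast)
  from tendsto_SUP_norm_0[OF this] show ?thesis by (simp only: eq simp_thms)
qed

end
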